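(* Consider an $n$-player continuous (differentiable) game with objective functions $V_1,\dots,V_n:\mathbb{R}^{nd}\to\mathbb{R}$, simultaneous gradient $\xi$, and Jacobian $\mathrm{J}=\nabla_{\bm\theta}\xi$ with antisymmetric part $A$. Suppose that the game is Hamiltonian, i.e. the symmetric part $S$ of $\mathrm{J}$ is identically zero. Let $\bm\theta^*\in\mathbb{R}^{nd}$ be a (local) Nash equilibrium, suppose that $\xi$ and $A$ are twice continuously differentiable, and suppose that $A(\bm\theta^* )$ is invertible. Then there exists $\epsilon>0$ such that, for every starting point $\bm\theta_0$ in the ball $B(\bm\theta^*,\epsilon)$ with center $\bm\theta^*$ and radius $\epsilon$, the iterates $$\bm\theta_{t+1}=\bm\theta_t-A(\bm\theta_t)^{-1}\xi(\bm\theta_t),\qquad t\ge 0,$$ converge to $\bm\theta^*$. Furthermore, the convergence rate is quadratic, i.e. there is a constant $C>0$ such that $\|\bm\theta_{t+1}-\bm\theta^*\|\le C\|\bm\theta_t-\bm\theta^*\|^2$ for all $t\ge 0$.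
   Context: There are $n$ agents; agent $i$ controls a parameter $\bm\theta_i\in\mathbb{R}^d$ and wants to minimize a twice differentiable function $V_i(\bm\theta)$ of the joint parameter $\bm\theta=(\bm\theta_1^T,\dots,\bm\theta_n^T)^T\in\mathbb{R}^{nd}$. No convexity of $V_i$ is assumed. $\bm\theta_{-i}$ denotes the parameters of all agents other than $i$, and $\|\cdot\|$ is the Euclidean norm. The simultaneous gradient is $\xi(\bm\theta)=(\nabla_{\bm\theta_1}V_1(\bm\theta)^T,\dots,\nabla_{\bm\theta_n}V_n(\bm\theta)^T)^T\in\mathbb{R}^{nd}$. The Jacobian of the game is the $nd\times nd$ matrix $\mathrm{J}(\bm\theta)=\nabla_{\bm\theta}\xi(\bm\theta)$, whose $(i,j)$ block is $\nabla_{\bm\theta_i,\bm\theta_j}V_i$. It decomposes as $\mathrm{J}=S+A$ with $S=\frac12(\mathrm{J}+\mathrm{J}^T)$ and $A=\frac12(\mathrm{J}-\mathrm{J}^T)$. The game is called Hamiltonian if $S(\bm\theta)=0$ for all $\bm\theta$. A point $\bm\theta^*$ is a local Nash equilibrium if for every $i$ there is a neighborhood $B_i$ of $\bm\theta_i^*$ in $\mathbb{R}^d$ such that $V_i(\bm\theta_i,\bm\theta_{-i}^* )\ge V_i(\bm\theta_i^*,\bm\theta_{-i}^* )$ for all $\bm\theta_i\in B_i$. *)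

theory Defs
  imports "HOL-Analysis.Analysis"
begin

text \<open>
  The finite types \<open>'n\<close> and \<open>'d\<close> index the agents and the coordinates of one agent's parameter.
  A joint parameter is a vector of type \<open>real ^ ('n \<times> 'd)\<close>, whose entry \<open>(i, k)\<close> is coordinate
  \<open>k\<close> of agent \<open>i\<close>; its norm is the Euclidean norm on \<open>nd\<close>-dimensional space, and game Jacobians
  are ordinary square matrices over the index type \<open>'n \<times> 'd\<close>.
\<close>

definition block :: "'n::finite \<Rightarrow> real ^ ('n \<times> 'd::finite) \<Rightarrow> real ^ 'd"
  where "block i \<theta> = (\<chi> k. \<theta> $ (i, k))"

definition with_block :: "'n::finite \<Rightarrow> real ^ 'd::finite \<Rightarrow> real ^ ('n \<times> 'd) \<Rightarrow> real ^ ('n \<times> 'd)"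
  where "with_block i \<phi> \<theta> = (\<chi> p. if fst p = i then \<phi> $ snd p else \<theta> $ p)"

definition twice_differentiable :: "('a::real_normed_vector \<Rightarrow> 'b::real_normed_vector) \<Rightarrow> bool"
  where "twice_differentiable f \<longleftrightarrow>
    (\<exists>f' :: 'a \<Rightarrow> 'a \<Rightarrow>\<^sub>L 'b.
       (\<forall>x. (f has_derivative blinfun_apply (f' x)) (at x)) \<and>
       (\<forall>x. f' differentiable (at x)))"

definition twice_continuously_differentiable ::
    "('a::real_normed_vector \<Rightarrow> 'b::real_normed_vector) \<Rightarrow> bool"
  where "twice_continuously_differentiable f \<longleftrightarrow>
    (\<exists>(f' :: 'a \<Rightarrow> 'a \<Rightarrow>\<^sub>L 'b) (f'' :: 'a \<Rightarrow> 'a \<Rightarrow>\<^sub>L 'a \<Rightarrow>\<^sub>L 'b).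
       (\<forall>x. (f has_derivative blinfun_apply (f' x)) (at x)) \<and>
       (\<forall>x. (f' has_derivative blinfun_apply (f'' x)) (at x)) \<and>
       continuous_on UNIV f'')"

definition gradient :: "('a::real_inner \<Rightarrow> real) \<Rightarrow> 'a \<Rightarrow> 'a"
  where "gradient f x = (THE D. GDERIV f x :> D)"

lemma gradient_eqI:
  assumes "GDERIV f x :> D"
  shows "gradient f x = D"
proof -
  have "D' = D" if "GDERIV f x :> D'" for D'
  proof -
    have "(\<lambda>h. inner h D') = (\<lambda>h. inner h D)"
      using assms that has_derivative_unique unfolding gderiv_def by blast
    then have "\<forall>h. inner h D' = inner h D"
      by metis
    then show ?thesis
      using vector_eq_ldot by blast
  qed
  with assms show ?thesis
    unfolding gradient_def by blast
qed

definition block_gradient :: "'n::finite \<Rightarrow> (real ^ ('n \<times> 'd::finite) \<Rightarrow> real) \<Rightarrow> real ^ ('n \<times> 'd) \<Rightarrow> real ^ 'd"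
  where "block_gradient i f \<theta> = gradient (\<lambda>\<phi>. f (with_block i \<phi> \<theta>)) (block i \<theta>)"

definition simultaneous_gradient ::
    "('n::finite \<Rightarrow> real ^ ('n \<times> 'd::finite) \<Rightarrow> real) \<Rightarrow> real ^ ('n \<times> 'd) \<Rightarrow> real ^ ('n \<times> 'd)"
  where "simultaneous_gradient V \<theta> = (\<chi> p. block_gradient (fst p) (V (fst p)) \<theta> $ snd p)"

definition game_jacobian ::
    "('n::finite \<Rightarrow> real ^ ('n \<times> 'd::finite) \<Rightarrow> real) \<Rightarrow> real ^ ('n \<times> 'd)
      \<Rightarrow> real ^ ('n \<times> 'd) ^ ('n \<times> 'd)"
  where "game_jacobian V \<theta> = jacobian (simultaneous_gradient V) (at \<theta>)"

definition symmetric_part ::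
    "('n::finite \<Rightarrow> real ^ ('n \<times> 'd::finite) \<Rightarrow> real) \<Rightarrow> real ^ ('n \<times> 'd)
      \<Rightarrow> real ^ ('n \<times> 'd) ^ ('n \<times> 'd)"
  where "symmetric_part V \<theta> = (1/2) *\<^sub>R (game_jacobian V \<theta> + transpose (game_jacobian V \<theta>))"

definition antisymmetric_part ::
    "('n::finite \<Rightarrow> real ^ ('n \<times> 'd::finite) \<Rightarrow> real) \<Rightarrow> real ^ ('n \<times> 'd)
      \<Rightarrow> real ^ ('n \<times> 'd) ^ ('n \<times> 'd)"
  where "antisymmetric_part V \<theta> = (1/2) *\<^sub>R (game_jacobian V \<theta> - transpose (game_jacobian V \<theta>))"

definition hamiltonian_game ::
    "('n::finite \<Rightarrow> real ^ ('n \<times> 'd::finite) \<Rightarrow> real) \<Rightarrow> bool"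
  where "hamiltonian_game V \<longleftrightarrow> (\<forall>\<theta>. symmetric_part V \<theta> = 0)"

definition local_nash_equilibrium ::
    "('n::finite \<Rightarrow> real ^ ('n \<times> 'd::finite) \<Rightarrow> real) \<Rightarrow> real ^ ('n \<times> 'd) \<Rightarrow> bool"
  where "local_nash_equilibrium V \<theta>' \<longleftrightarrow>
    (\<forall>i. \<exists>B. open B \<and> block i \<theta>' \<in> B \<and>
       (\<forall>\<phi>\<in>B. V i (with_block i \<phi> \<theta>') \<ge> V i \<theta>'))"

end

theory Submission
  imports Defs
begin

text \<open>
  For a Hamiltonian game \<open>A\<close> is the full Jacobian of \<open>\<xi>\<close>, so the iteration is Newton's method for
  the equation \<open>\<xi> = 0\<close>, and a local Nash equilibrium is a root of \<open>\<xi>\<close> by the first-order optimality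
  condition of every agent. Since \<open>A\<close> is Lipschitz at \<open>\<theta>'\<close>, the mean value inequality bounds the
  residual \<open>\<xi> \<theta> - A(\<theta>) (\<theta> - \<theta>')\<close> quadratically, and since \<open>A\<close> is uniformly bounded below near
  \<open>\<theta>'\<close>, the Newton error inherits this bound.
\<close>

lemma with_block_block [simp]: "with_block i (block i \<theta>) \<theta> = \<theta>"
  by (auto simp: with_block_def block_def vec_eq_iff)

lemma with_block_differentiable:
  fixes i :: "'n::finite" and \<theta> :: "real ^ ('n \<times> 'd::finite)"
  shows "(\<lambda>\<phi>. with_block i \<phi> \<theta>) differentiable (at \<phi>0)"
proof -
  \<comment> \<open>The map is affine: the inserted block enters linearly, the other agents' entries
    form a constant.\<close>
  have "(\<lambda>\<phi>. with_block i \<phi> \<theta>) = (\<lambda>\<phi>. with_block i \<phi> 0 + with_block i 0 \<theta>)"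
    by (auto simp: with_block_def vec_eq_iff)
  moreover have "linear (\<lambda>\<phi>. with_block i \<phi> (0 :: real ^ ('n \<times> 'd)))"
    by (rule linearI) (auto simp: with_block_def vec_eq_iff)
  ultimately show ?thesis
    using linear_imp_differentiable by fastforce
qed

text \<open>With the other agents frozen, each objective has an interior local minimum in its own
  block. Since \<open>gradient\<close> is a definite description, an actual derivative must be
  exhibited; the chain rule supplies it and minimality makes it zero.\<close>

lemma nash_imp_simultaneous_gradient_zero:
  fixes \<theta> :: "real ^ ('n::finite \<times> 'd::finite)"
  assumes diff: "\<And>i. V i differentiable (at \<theta>)"
    and nash: "local_nash_equilibrium V \<theta>"
  shows "simultaneous_gradient V \<theta> = 0"
proof -
  have "block_gradient i (V i) \<theta> = 0" for i
  proof -
    let ?f = "\<lambda>\<phi>. V i (with_block i \<phi> \<theta>)"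
    have "?f differentiable (at (block i \<theta>))"
      using differentiable_chain_at[OF with_block_differentiable, of "V i" i "block i \<theta>" \<theta>] diff
      by (simp add: o_def)
    then obtain f' where f': "(?f has_derivative f') (at (block i \<theta>))"
      unfolding differentiable_def by blast
    obtain B where "open B" "block i \<theta> \<in> B" "\<forall>\<phi>\<in>B. ?f (block i \<theta>) \<le> ?f \<phi>"
      using nash unfolding local_nash_equilibrium_def by auto
    then have "f' = (\<lambda>h. 0)"
      using differential_zero_maxmin[OF _ _ f'] by blast
    with f' have "GDERIV ?f (block i \<theta>) :> 0"
      by (simp add: gderiv_def)
    then show ?thesis
      unfolding block_gradient_def by (rule gradient_eqI)
  qed
  then show ?thesis
    by (simp add: simultaneous_gradient_def vec_eq_iff)
qed

lemma hamiltonian_game_jacobian: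
  assumes "hamiltonian_game V"
  shows "game_jacobian V \<theta> = antisymmetric_part V \<theta>"
proof -
  have "game_jacobian V \<theta> = symmetric_part V \<theta> + antisymmetric_part V \<theta>"
    by (auto simp: symmetric_part_def antisymmetric_part_def vec_eq_iff field_simps)
  with assms show ?thesis
    by (simp add: hamiltonian_game_def)
qed

text \<open>The norm on matrices here is the Euclidean norm of the entries, not the operator norm.
  The constant lets a Lipschitz bound on a matrix-valued map control its action on vectors.\<close>

lemma norm_matrix_vector_mult_le:
  obtains K where "K > 0"
    and "\<And>(M :: real^'m::finite^'k::finite) x. norm (M *v x) \<le> K * norm M * norm x"
proof -
  have "bilinear (\<lambda>(M :: real^'m^'k) x. M *v x)"
    unfolding bilinear_def
    by (auto intro!: linearI simp: matrix_vector_mult_add_rdistrib matrix_vector_right_distrib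
        matrix_vector_mult_scaleR scaleR_matrix_vector_assoc)
  then obtain K where "K > 0" "\<And>(M :: real^'m^'k) x. norm (M *v x) \<le> K * norm M * norm x"
    using bilinear_bounded_pos by blast
  then show ?thesis
    using that by blast
qed

text \<open>One endpoint stays fixed at \<open>x\<close>. The constant is a bound for the derivative
  plus 1 for the first-order remainder.\<close>

lemma differentiable_imp_locally_Lipschitz_at:
  assumes "f differentiable (at x)"
  obtains L r where "L > 0" "r > 0" "\<And>y. norm (y - x) < r \<Longrightarrow> norm (f y - f x) \<le> L * norm (y - x)"
proof -
  obtain f' where f': "(f has_derivative f') (at x)"
    using assms unfolding differentiable_def by blast
  then obtain K where K: "K > 0" "\<And>h. norm (f' h) \<le> norm h * K"
    using bounded_linear.pos_bounded has_derivative_bounded_linear by blast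
  obtain r where "r > 0"
    and r: "\<And>y. norm (y - x) < r \<Longrightarrow> norm (f y - f x - f' (y - x)) \<le> 1 * norm (y - x)"
    using f' unfolding has_derivative_at_alt by (metis zero_less_one)
  have "norm (f y - f x) \<le> (K + 1) * norm (y - x)" if "norm (y - x) < r" for y
    using r[OF that] K(2)[of "y - x"] norm_triangle_sub[of "f y - f x" "f' (y - x)"]
    by (simp add: algebra_simps)
  with \<open>r > 0\<close> K(1) show ?thesis
    using that[of "K + 1" r] by auto
qed

lemma matrix_inv_right:
  assumes "invertible M"
  shows "M ** matrix_inv M = mat 1"
  using assms unfolding invertible_def matrix_inv_def
  by (rule someI2_ex) simp

text \<open>An injective linear map in finite dimension is bounded below; this replaces a norm bound
  on the inverse matrix.\<close>

lemma invertible_matrix_bounded_below: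
  fixes M :: "real^'m::finite^'m"
  assumes "invertible M"
  obtains c where "c > 0" "\<And>x. c * norm x \<le> norm (M *v x)"
proof -
  have "inj ((*v) M)"
    using assms inj_matrix_vector_mult by blast
  then show ?thesis
    using that linear_inj_bounded_below_pos[OF matrix_vector_mul_linear, of M] by blast
qed

text \<open>The smallness condition turns the quadratic estimate into halving of the error. As the
  estimate is assumed only inside the ball, staying in the ball and geometric decay are proved in
  one induction.\<close>

lemma quadratic_contraction_converges:
  fixes x :: "nat \<Rightarrow> 'a::real_normed_vector"
  assumes "C > 0" and small: "C * \<epsilon> \<le> 1/2"
    and step: "\<And>t. norm (x t - z) < \<epsilon> \<Longrightarrow> norm (x (Suc t) - z) \<le> C * (norm (x t - z))\<^sup>2"
    and start: "norm (x 0 - z) < \<epsilon>"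
  shows "norm (x t - z) < \<epsilon>" and "x \<longlonglongrightarrow> z"
proof -
  have halve: "norm (x (Suc t) - z) \<le> norm (x t - z) / 2" if "norm (x t - z) < \<epsilon>" for t
  proof -
    have "C * norm (x t - z) \<le> 1/2"
      using small mult_left_mono[of "norm (x t - z)" \<epsilon> C] that \<open>C > 0\<close> by linarith
    then have "C * norm (x t - z) * norm (x t - z) \<le> 1/2 * norm (x t - z)"
      by (intro mult_right_mono) auto
    with step[OF that] show ?thesis
      by (simp add: power2_eq_square mult.assoc)
  qed
  have inv: "norm (x t - z) < \<epsilon> \<and> norm (x t - z) \<le> (1/2) ^ t * norm (x 0 - z)" for t
  proof (induction t)
    case (Suc t)
    then have "norm (x (Suc t) - z) \<le> norm (x t - z) / 2"
      using halve by blast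
    moreover have "norm (x t - z) / 2 \<le> (1/2) ^ Suc t * norm (x 0 - z)"
      using Suc by simp
    ultimately show ?case
      using Suc norm_ge_zero[of "x (Suc t) - z"] by linarith
  qed (use start in auto)
  then show "norm (x t - z) < \<epsilon>"
    by blast
  have "(\<lambda>t. (1/2 :: real) ^ t * norm (x 0 - z)) \<longlonglongrightarrow> 0"
    by (intro tendsto_mult_left_zero LIMSEQ_power_zero) auto
  then have "(\<lambda>t. x t - z) \<longlonglongrightarrow> 0"
    by (rule Lim_null_comparison[rotated]) (use inv in auto)
  then show "x \<longlonglongrightarrow> z"
    by (simp add: LIM_zero_iff)
qed

lemma newton_step_quadratic:
  fixes f :: "real^'m::finite \<Rightarrow> real^'m" and A :: "real^'m \<Rightarrow> real^'m^'m"
  assumes deriv: "\<And>x. (f has_derivative (\<lambda>h. A x *v h)) (at x)"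
    and "A differentiable (at z)" and "f z = 0" and "invertible (A z)"
  obtains r C where "r > 0" "C > 0"
    and "\<And>x. norm (x - z) < r \<Longrightarrow> invertible (A x)"
    and "\<And>x. norm (x - z) < r \<Longrightarrow>
      norm (x - matrix_inv (A x) *v f x - z) \<le> C * (norm (x - z))\<^sup>2"
proof -
  obtain K where K: "K > 0" "\<And>(M :: real^'m^'m) x. norm (M *v x) \<le> K * norm M * norm x"
    using norm_matrix_vector_mult_le by blast
  obtain L r where "L > 0" "r > 0"
    and L: "\<And>y. norm (y - z) < r \<Longrightarrow> norm (A y - A z) \<le> L * norm (y - z)"
    using differentiable_imp_locally_Lipschitz_at[OF assms(2)] by blast
  define N where "N = K * L"
  have "N > 0"
    using K(1) \<open>L > 0\<close> by (simp add: N_def)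
  have N: "norm ((A y - A z) *v h) \<le> N * norm (y - z) * norm h" if "norm (y - z) < r" for y h
  proof -
    have "K * norm (A y - A z) * norm h \<le> K * (L * norm (y - z)) * norm h"
      using L[OF that] K(1) by (intro mult_right_mono mult_left_mono) auto
    with K(2)[of "A y - A z" h] show ?thesis
      by (simp add: N_def mult.assoc)
  qed
  obtain c where "c > 0" and c: "\<And>h. c * norm h \<le> norm (A z *v h)"
    using invertible_matrix_bounded_below[OF assms(4)] by blast
  \<comment> \<open>Within distance \<open>c / (2 * N)\<close> of \<open>z\<close>, replacing
    \<open>A z\<close> by \<open>A x\<close> costs at most half of the lower bound
    \<open>c\<close>.\<close>
  define s where "s = min r (c / (2 * N))"
  have "s > 0"
    using \<open>r > 0\<close> \<open>c > 0\<close> \<open>N > 0\<close> by (simp add: s_def)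
  have below: "c / 2 * norm h \<le> norm (A x *v h)" if x: "norm (x - z) < s" for x h
  proof -
    have "N * norm (x - z) \<le> c / 2"
      using x \<open>N > 0\<close> by (simp add: s_def field_simps)
    then have "N * norm (x - z) * norm h \<le> c / 2 * norm h"
      by (rule mult_right_mono) simp
    moreover have "norm ((A x - A z) *v h) \<le> N * norm (x - z) * norm h"
      using x by (intro N) (simp add: s_def)
    moreover have "norm (A z *v h) \<le> norm (A x *v h) + norm ((A x - A z) *v h)"
      by (metis matrix_vector_mult_diff_rdistrib norm_triangle_sub norm_minus_commute)
    ultimately show ?thesis
      using c[of h] by (simp add: field_simps)
  qed
  have inv: "invertible (A x)" if "norm (x - z) < s" for x
  proof -
    have "h = 0" if "A x *v h = 0" for h
      using below[OF \<open>norm (x - z) < s\<close>, of h] that \<open>c > 0\<close> by (simp add: mult_le_0_iff)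
    then show ?thesis
      by (simp add: invertible_left_inverse matrix_left_invertible_ker)
  qed
  have residual: "norm (f x - A x *v (x - z)) \<le> 2 * N * (norm (x - z))\<^sup>2"
    if x: "norm (x - z) < s" for x
  proof -
    \<comment> \<open>This convex set contains both \<open>x\<close> and \<open>z\<close>, and none
      of its points is farther from \<open>z\<close> than \<open>x\<close> is.\<close>
    let ?B = "cball z (norm (x - z))"
    \<comment> \<open>With \<open>x\<close> frozen, the derivative of \<open>?g\<close> at
      \<open>y\<close> is \<open>A y - A x\<close>, and \<open>?g x - ?g z\<close> is the residual
      because \<open>f z = 0\<close>.\<close>
    let ?g = "\<lambda>y. f y - A x *v y"
    have "norm (?g x - ?g z) \<le> (2 * N * norm (x - z)) * norm (x - z)"
    proof (rule differentiable_bound[of ?B ?g "\<lambda>y h. A y *v h - A x *v h"])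
      fix y assume y: "y \<in> ?B"
      have "((\<lambda>y. A x *v y) has_derivative (\<lambda>h. A x *v h)) (at y)"
        by (intro bounded_linear_imp_has_derivative matrix_vector_mul_bounded_linear)
      from has_derivative_diff[OF deriv this]
      show "(?g has_derivative (\<lambda>h. A y *v h - A x *v h)) (at y within ?B)"
        by (rule has_derivative_at_withinI)
      show "onorm (\<lambda>h. A y *v h - A x *v h) \<le> 2 * N * norm (x - z)"
      proof (rule onorm_le)
        fix h
        have yx: "norm (y - z) \<le> norm (x - z)"
          using y by (simp add: dist_norm norm_minus_commute)
        \<comment> \<open>The Lipschitz bound is available only relative to \<open>z\<close>, so the
          comparison passes through \<open>A z\<close>; this produces the factor 2.\<close>
        have "A y *v h - A x *v h = (A y - A z) *v h - (A x - A z) *v h"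
          by (simp add: matrix_vector_mult_diff_rdistrib)
        then have "norm (A y *v h - A x *v h) \<le> norm ((A y - A z) *v h) + norm ((A x - A z) *v h)"
          by (metis norm_triangle_ineq4)
        also have "\<dots> \<le> N * norm (y - z) * norm h + N * norm (x - z) * norm h"
          using x yx by (intro add_mono N) (auto simp: s_def)
        also have "\<dots> \<le> N * norm (x - z) * norm h + N * norm (x - z) * norm h"
          using yx \<open>N > 0\<close> by (intro add_right_mono mult_right_mono mult_left_mono) auto
        finally show "norm (A y *v h - A x *v h) \<le> 2 * N * norm (x - z) * norm h"
          by (simp add: algebra_simps)
      qed
    qed (auto simp: dist_norm norm_minus_commute)
    then show ?thesis
      using \<open>f z = 0\<close>
      by (simp add: matrix_vector_mult_diff_distrib power2_eq_square algebra_simps)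
  qed
  have "norm (x - matrix_inv (A x) *v f x - z) \<le> 4 * N / c * (norm (x - z))\<^sup>2"
    if x: "norm (x - z) < s" for x
  proof -
    \<comment> \<open>Applying \<open>A x\<close> to the new error cancels the inverse and leaves
      the negated residual. Dividing its bound by the lower bound \<open>c / 2\<close> yields the
      constant \<open>4 * N / c\<close>.\<close>
    have "A x *v (x - matrix_inv (A x) *v f x - z) = A x *v (x - z) - f x"
      using matrix_inv_right[OF inv[OF x]]
      by (simp add: matrix_vector_mult_diff_distrib matrix_vector_mul_assoc)
    then have "c / 2 * norm (x - matrix_inv (A x) *v f x - z) \<le> 2 * N * (norm (x - z))\<^sup>2"
      by (metis below[OF x] residual[OF x] norm_minus_commute order_trans)
    with \<open>c > 0\<close> show ?thesis
      by (simp add: field_simps)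
  qed
  with inv \<open>s > 0\<close> \<open>N > 0\<close> \<open>c > 0\<close> show ?thesis
    using that[of s "4 * N / c"] by simp
qed

text \<open>Invertibility along the orbit is part of the conclusion because
  \<open>matrix_inv\<close> of a singular matrix is an unspecified value. Both constants are chosen
  before the sequence, hence are uniform in the starting point.\<close>

lemma newton_converges_quadratically:
  fixes f :: "real^'m::finite \<Rightarrow> real^'m" and A :: "real^'m \<Rightarrow> real^'m^'m"
  assumes "\<And>x. (f has_derivative (\<lambda>h. A x *v h)) (at x)"
    and "A differentiable (at z)" and "f z = 0" and "invertible (A z)"
  shows "\<exists>\<epsilon>>0. \<exists>C>0. \<forall>x :: nat \<Rightarrow> real^'m. x 0 \<in> ball z \<epsilon> \<longrightarrow>
    (\<forall>t. x (Suc t) = x t - matrix_inv (A (x t)) *v f (x t)) \<longrightarrow>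
    (\<forall>t. invertible (A (x t))) \<and> x \<longlonglongrightarrow> z \<and>
    (\<forall>t. norm (x (Suc t) - z) \<le> C * (norm (x t - z))\<^sup>2)"
proof -
  obtain r C where rC: "r > 0" "C > 0"
    and inv: "\<And>x. norm (x - z) < r \<Longrightarrow> invertible (A x)"
    and step: "\<And>x. norm (x - z) < r \<Longrightarrow>
      norm (x - matrix_inv (A x) *v f x - z) \<le> C * (norm (x - z))\<^sup>2"
    using newton_step_quadratic[OF assms] by blast
  \<comment> \<open>The first bound keeps the step estimate applicable, the second makes each step
    at least halve the error.\<close>
  define \<epsilon> where "\<epsilon> = min r (1 / (2 * C))"
  have \<epsilon>: "\<epsilon> > 0" "\<epsilon> \<le> r" "C * \<epsilon> \<le> 1/2"
    using rC by (auto simp: \<epsilon>_def min_def field_simps)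
  have "(\<forall>t. invertible (A (x t))) \<and> x \<longlonglongrightarrow> z \<and>
      (\<forall>t. norm (x (Suc t) - z) \<le> C * (norm (x t - z))\<^sup>2)"
    if start: "x 0 \<in> ball z \<epsilon>"
      and iter: "\<forall>t. x (Suc t) = x t - matrix_inv (A (x t)) *v f (x t)"
    for x :: "nat \<Rightarrow> real^'m"
  proof -
    have *: "norm (x (Suc t) - z) \<le> C * (norm (x t - z))\<^sup>2" if "norm (x t - z) < \<epsilon>" for t
      using step[of "x t"] iter that \<epsilon>(2) by simp
    have "norm (x 0 - z) < \<epsilon>"
      using start by (simp add: dist_norm norm_minus_commute)
    note conv = quadratic_contraction_converges[OF rC(2) \<epsilon>(3) * this]
    have "invertible (A (x t))" for t
      using conv(1)[of t] \<epsilon>(2) by (intro inv) simp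
    with conv * show ?thesis
      by simp
  qed
  with \<epsilon>(1) rC(2) show ?thesis
    by blast
qed

theorem theorem1:
  fixes V :: "'n::finite \<Rightarrow> real ^ ('n \<times> 'd::finite) \<Rightarrow> real"
    and \<theta>' :: "real ^ ('n \<times> 'd)"
  assumes "\<And>i. twice_differentiable (V i)"
    and "hamiltonian_game V"
    and "local_nash_equilibrium V \<theta>'"
    and "twice_continuously_differentiable (simultaneous_gradient V)"
    and "twice_continuously_differentiable (antisymmetric_part V)"
    and "invertible (antisymmetric_part V \<theta>')"
  shows "\<exists>\<epsilon>>0. \<exists>C>0. \<forall>\<theta> :: nat \<Rightarrow> real ^ ('n \<times> 'd).
    \<theta> 0 \<in> ball \<theta>' \<epsilon> \<longrightarrow>
    (\<forall>t. \<theta> (Suc t) = \<theta> t - matrix_inv (antisymmetric_part V (\<theta> t)) *v simultaneous_gradient V (\<theta> t)) \<longrightarrow>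
    (\<forall>t. invertible (antisymmetric_part V (\<theta> t))) \<and>
    \<theta> \<longlonglongrightarrow> \<theta>' \<and>
    (\<forall>t. norm (\<theta> (Suc t) - \<theta>') \<le> C * (norm (\<theta> t - \<theta>'))\<^sup>2)"
proof (rule newton_converges_quadratically)
  fix \<theta>
  \<comment> \<open>Differentiability is what makes the matrix
    \<open>game_jacobian V \<theta>\<close> represent the derivative of \<xi>; the Hamiltonian
    condition then identifies it with the antisymmetric part.\<close>
  have "simultaneous_gradient V differentiable (at \<theta>)"
    using assms(4) unfolding twice_continuously_differentiable_def differentiable_def by blast
  then show "(simultaneous_gradient V has_derivative (\<lambda>h. antisymmetric_part V \<theta> *v h)) (at \<theta>)"
    using hamiltonian_game_jacobian[OF assms(2), of \<theta>]
    by (simp add: jacobian_works game_jacobian_def)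
next
  show "antisymmetric_part V differentiable (at \<theta>')"
    using assms(5) unfolding twice_continuously_differentiable_def differentiable_def by blast
next
  have "V i differentiable (at \<theta>')" for i
    using assms(1)[of i] unfolding twice_differentiable_def differentiable_def by blast
  then show "simultaneous_gradient V \<theta>' = 0"
    using assms(3) by (rule nash_imp_simultaneous_gradient_zero)
qed (fact assms(6))

end
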